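(* The spacelike Type II translation surfaces $\mathcal{F}(u,v)=(u,f(u)+g(v),v)$ in Minkowski space $\mathbb{R}^3_1$ that are minimal with respect to the semi-symmetric metric connection $\nabla$ are of the following forms: (i) $\mathcal{F}(u,v)=\Big(u,\ \frac{1-c^2}{2c}\ln\Big|\cos\Big(\frac{2c}{\sqrt{1-c^2}}u-a\Big)\Big|+cv+b,\ v\Big)$, where $a,b,c$ are constants with $c\neq 0$ and $c^2<1$; (ii) $\mathcal{F}(u,v)=\Big(u,\ \int_0^u\frac{\sqrt{c^2-1}+d\,e^{\frac{4c}{\sqrt{c^2-1}}x}}{1-d\,e^{\frac{4c}{\sqrt{c^2-1}}x}}\,dx+cv+b,\ v\Big)$, where $b,c,d$ are constants with $c^2>1$ and $d\neq 0$; (iii) $\mathcal{F}(u,v)=\Big(u,\ \int_0^v\frac{\pm 1}{\sqrt{a e^{-4x}+\frac{1}{c^2+1}}}\,dx+cu+b,\ v\Big)$, where $a,b,c$ are constants with $a\neq 0$; (iv) $\mathcal{F}(u,v)=(u,\ c_0u+c_1v+b,\ v)$, where $b,c_0,c_1$ are constants with $c_1=0$ or $c_1^2-c_0^2-2=0$.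
   Context: $\mathbb{R}^3_1$ is $\mathbb{R}^3$ with the Minkowski metric $\widetilde g_1=dx^2+dy^2-dz^2$, coordinate fields $X_1=\partial_x$, $X_2=\partial_y$, $X_3=\partial_z$ and Levi-Civita connection $\nabla^L$ (so $\nabla^L_{X_i}X_j=0$). The semi-symmetric metric connection $\nabla$ is $$\nabla_XY=\nabla^L_XY+\widetilde g_1(Y,X_3)X-\widetilde g_1(X,Y)X_3 .$$ A Type II translation surface is a surface parametrized by $\mathcal{F}(u,v)=(u,f(u)+g(v),v)$, where $f$ and $g$ are smooth functions on open sets of $\mathbb{R}$. A surface is spacelike if the metric induced on it by $\widetilde g_1$ is Riemannian. For a spacelike surface $M$ parametrized by $\mathcal{F}(u,v)$, put $E_1=\mathcal{F}_u$, $E_2=\mathcal{F}_v$, let $N$ be a unit (timelike) normal field, and let $E=\widetilde g_1(\mathcal{F}_u,\mathcal{F}_u)$, $F=\widetilde g_1(\mathcal{F}_u,\mathcal{F}_v)$, $G=\widetilde g_1(\mathcal{F}_v,\mathcal{F}_v)$. $M$ is minimal with respect to $\nabla$ if its mean curvature with respect to $\nabla$ vanishes, i.e. $$G\,\widetilde g_1(\nabla_{E_1}E_1,N)-F\,\widetilde g_1(\nabla_{E_1}E_2,N)-F\,\widetilde g_1(\nabla_{E_2}E_1,N)+E\,\widetilde g_1(\nabla_{E_2}E_2,N)=0 .$$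
   Formalization: In (ii) the integrand's numerator is corrected to √(c²−1)(1+d e^{4cx/√(c²−1)}), as the printed one fails unless c²=2; in (iii) the lower limit is a point of v's domain (0 if it lies there); constants are taken on each connected component of the domains. *)

theory Defs
  imports "HOL-Analysis.Analysis"
begin

section \<open>Minkowski space and the semi-symmetric metric connection\<close>

definition minkowski :: "real^3 \<Rightarrow> real^3 \<Rightarrow> real" where
  "minkowski x y = x $ 1 * y $ 1 + x $ 2 * y $ 2 - x $ 3 * y $ 3"

definition X3 :: "real^3" where
  "X3 = axis 3 1"

text \<open>The coordinate fields are parallel for the Levi-Civita connection, so the covariant
  derivative of \<open>Y\<close> along \<open>X\<close> is the directional derivative of the components of \<open>Y\<close>.\<close>

definition levi_civita :: "(real^3 \<Rightarrow> real^3) \<Rightarrow> (real^3 \<Rightarrow> real^3) \<Rightarrow> real^3 \<Rightarrow> real^3" where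
  "levi_civita X Y p = frechet_derivative Y (at p) (X p)"

definition nabla :: "(real^3 \<Rightarrow> real^3) \<Rightarrow> (real^3 \<Rightarrow> real^3) \<Rightarrow> real^3 \<Rightarrow> real^3" where
  "nabla X Y p = levi_civita X Y p + minkowski (Y p) X3 *\<^sub>R X p - minkowski (X p) (Y p) *\<^sub>R X3"

section \<open>Parametrized surfaces\<close>

type_synonym surface = "real \<Rightarrow> real \<Rightarrow> real^3"

definition du :: "surface \<Rightarrow> surface" where
  "du \<F> u v = vector_derivative (\<lambda>s. \<F> s v) (at u)"

definition dv :: "surface \<Rightarrow> surface" where
  "dv \<F> u v = vector_derivative (\<lambda>t. \<F> u t) (at v)"

text \<open>The fields \<open>E\<^sub>1 = du \<F>\<close> and \<open>E\<^sub>2 = dv \<F>\<close> are defined on the surface only, so \<open>nabla\<close> is applied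
  to them as the induced connection on vector fields \<open>Z\<close> along \<open>\<F>\<close>; the direction \<open>D\<close> is \<open>du\<close> or
  \<open>dv\<close>.  The lemmas below say that the result is \<open>nabla X Y\<close> at \<open>\<F> u v\<close> for all vector fields
  \<open>X\<close>, \<open>Y\<close> on the ambient space that extend \<open>D \<F>\<close> and \<open>Z\<close>.\<close>

definition nabla_along :: "(surface \<Rightarrow> surface) \<Rightarrow> surface \<Rightarrow> surface \<Rightarrow> surface" where
  "nabla_along D \<F> Z u v =
     D Z u v + minkowski (Z u v) X3 *\<^sub>R D \<F> u v - minkowski (D \<F> u v) (Z u v) *\<^sub>R X3"

lemma vector_derivative_compose_eq:
  fixes Y :: "real^3 \<Rightarrow> real^3" and c z :: "real \<Rightarrow> real^3"
  assumes "Y differentiable (at (c t))" "c differentiable (at t)"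
    and "eventually (\<lambda>s. Y (c s) = z s) (nhds t)"
  shows "vector_derivative z (at t) = frechet_derivative Y (at (c t)) (vector_derivative c (at t))"
proof -
  have c: "(c has_vector_derivative vector_derivative c (at t)) (at t)"
    using assms(2) by (simp add: vector_derivative_works)
  have Y: "(Y has_derivative frechet_derivative Y (at (c t))) (at (c t))"
    using assms(1) by (simp add: frechet_derivative_works)
  have "((Y \<circ> c) has_vector_derivative
      frechet_derivative Y (at (c t)) (vector_derivative c (at t))) (at t)"
    by (rule vector_derivative_diff_chain_within[OF c])
       (use Y in \<open>auto intro: has_derivative_at_withinI\<close>)
  moreover obtain S where "open S" "t \<in> S" "\<And>s. s \<in> S \<Longrightarrow> (Y \<circ> c) s = z s"
    using assms(3) by (auto simp: eventually_nhds)
  ultimately have "(z has_vector_derivative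
      frechet_derivative Y (at (c t)) (vector_derivative c (at t))) (at t)"
    by (rule has_vector_derivative_transform_within_open)
  thus ?thesis by (rule vector_derivative_at)
qed

lemma nabla_along_du_eq_nabla:
  assumes "(\<lambda>s. \<F> s v) differentiable (at u)" "Y differentiable (at (\<F> u v))"
    and "eventually (\<lambda>s. Y (\<F> s v) = Z s v) (nhds u)" "X (\<F> u v) = du \<F> u v"
  shows "nabla_along du \<F> Z u v = nabla X Y (\<F> u v)"
  using vector_derivative_compose_eq[OF assms(2,1,3)] eventually_nhds_x_imp_x[OF assms(3)] assms(4)
  by (simp add: nabla_along_def nabla_def levi_civita_def du_def)

lemma nabla_along_dv_eq_nabla:
  assumes "(\<lambda>t. \<F> u t) differentiable (at v)" "Y differentiable (at (\<F> u v))"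
    and "eventually (\<lambda>t. Y (\<F> u t) = Z u t) (nhds v)" "X (\<F> u v) = dv \<F> u v"
  shows "nabla_along dv \<F> Z u v = nabla X Y (\<F> u v)"
  using vector_derivative_compose_eq[OF assms(2,1,3)] eventually_nhds_x_imp_x[OF assms(3)] assms(4)
  by (simp add: nabla_along_def nabla_def levi_civita_def dv_def)

text \<open>The induced metric is positive definite on every tangent plane; in particular \<open>\<F>\<close> is an
  immersion.\<close>

definition spacelike :: "surface \<Rightarrow> real set \<Rightarrow> real set \<Rightarrow> bool" where
  "spacelike \<F> U V \<longleftrightarrow>
     (\<forall>u\<in>U. \<forall>v\<in>V. \<forall>\<alpha> \<beta>. (\<alpha>, \<beta>) \<noteq> (0, 0) \<longrightarrow>
        minkowski (\<alpha> *\<^sub>R du \<F> u v + \<beta> *\<^sub>R dv \<F> u v) (\<alpha> *\<^sub>R du \<F> u v + \<beta> *\<^sub>R dv \<F> u v) > 0)"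

definition unit_timelike_normal :: "surface \<Rightarrow> surface \<Rightarrow> real set \<Rightarrow> real set \<Rightarrow> bool" where
  "unit_timelike_normal \<F> N U V \<longleftrightarrow>
     (\<forall>u\<in>U. \<forall>v\<in>V. minkowski (N u v) (du \<F> u v) = 0 \<and> minkowski (N u v) (dv \<F> u v) = 0 \<and>
        minkowski (N u v) (N u v) = -1)"

definition coeff_E :: "surface \<Rightarrow> real \<Rightarrow> real \<Rightarrow> real" where
  "coeff_E \<F> u v = minkowski (du \<F> u v) (du \<F> u v)"

definition coeff_F :: "surface \<Rightarrow> real \<Rightarrow> real \<Rightarrow> real" where
  "coeff_F \<F> u v = minkowski (du \<F> u v) (dv \<F> u v)"

definition coeff_G :: "surface \<Rightarrow> real \<Rightarrow> real \<Rightarrow> real" where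
  "coeff_G \<F> u v = minkowski (dv \<F> u v) (dv \<F> u v)"

definition minimal :: "surface \<Rightarrow> surface \<Rightarrow> real set \<Rightarrow> real set \<Rightarrow> bool" where
  "minimal \<F> N U V \<longleftrightarrow>
     (\<forall>u\<in>U. \<forall>v\<in>V.
        coeff_G \<F> u v * minkowski (nabla_along du \<F> (du \<F>) u v) (N u v)
      - coeff_F \<F> u v * minkowski (nabla_along du \<F> (dv \<F>) u v) (N u v)
      - coeff_F \<F> u v * minkowski (nabla_along dv \<F> (du \<F>) u v) (N u v)
      + coeff_E \<F> u v * minkowski (nabla_along dv \<F> (dv \<F>) u v) (N u v) = 0)"

section \<open>Translation surfaces\<close>

text \<open>Meaningful for open \<open>S\<close>: \<open>f\<close> has derivatives of all orders on \<open>S\<close>.\<close>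

definition smooth_on :: "real set \<Rightarrow> (real \<Rightarrow> real) \<Rightarrow> bool" where
  "smooth_on S f \<longleftrightarrow> (\<forall>n. \<forall>x\<in>S. (deriv ^^ n) f field_differentiable (at x))"

definition translation_II :: "(real \<Rightarrow> real) \<Rightarrow> (real \<Rightarrow> real) \<Rightarrow> surface" where
  "translation_II f g u v = vector [u, f u + g v, v]"

end

theory Submission
  imports Defs
begin

text \<open>With \<open>p = f'\<close> and \<open>q = g'\<close>, being spacelike means \<open>q\<^sup>2 > 1 + p\<^sup>2\<close> on \<open>U \<times> V\<close>.  Every normal is a
  multiple of \<open>(-p, 1, q)\<close>, and minimality becomes the equation
  \<open>(q\<^sup>2 - 1) p' + (1 + p\<^sup>2) q' + 2 q (q\<^sup>2 - 1 - p\<^sup>2) = 0\<close> in two separated variables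
  (\<open>minimal_translation_II_imp_ode\<close>).

  Divide it by \<open>(1 + p\<^sup>2) (q\<^sup>2 - 1)\<close> and subtract its instances at two points \<open>u\<^sub>1\<close>, \<open>u\<^sub>2\<close> and the same
  \<open>v\<close>.  The term in \<open>q'\<close> cancels, and \<open>v\<close> enters what remains only through \<open>q\<^sup>3 / (q\<^sup>2 - 1)\<close>, whose
  coefficient is twice the difference of \<open>1 / (1 + p\<^sup>2)\<close> at \<open>u\<^sub>1\<close> and \<open>u\<^sub>2\<close>.  Hence
  either \<open>p\<^sup>2\<close> is constant, or every value of \<open>q\<close> is a root of one fixed nonzero cubic; on an interval a continuous function with values among the roots of a nonzero
  polynomial is constant, so \<open>p\<close> or \<open>q\<close> is constant (\<open>slope_constant_dichotomy\<close>).

  If \<open>p = c\<close>, the equation is linear in \<open>1 / q\<^sup>2\<close> and gives form (iii).  If \<open>q = c\<close>, it is a Riccati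
  equation for \<open>p\<close>, which the substitution \<open>(s + p) / (s - p)\<close> with \<open>s\<^sup>2 = c\<^sup>2 - 1\<close> makes linear; this
  gives form (ii), with \<open>d < 0\<close>.  In both cases \<open>q\<^sup>2 > 1 + p\<^sup>2\<close> excludes the constant solutions
  of these equations, so only these two of the four forms occur.\<close>

section \<open>The equation of a minimal translation surface\<close>

lemma vector3_eq_axis_sum:
  "(vector [a, b, c] :: real^3) = a *\<^sub>R axis 1 1 + b *\<^sub>R axis 2 1 + c *\<^sub>R axis 3 1"
  by (simp add: vec_eq_iff forall_3 axis_def)

lemma has_vector_derivative_vector3:
  assumes "(a has_real_derivative a') (at t)" "(b has_real_derivative b') (at t)"
    "(c has_real_derivative c') (at t)"
  shows "((\<lambda>s. vector [a s, b s, c s] :: real^3) has_vector_derivative vector [a', b', c']) (at t)"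
  unfolding vector3_eq_axis_sum
  by (rule has_vector_derivative_eq_rhs, (rule derivative_intros assms)+) simp

lemma X3_eq_vector: "X3 = vector [0, 0, 1]"
  by (simp add: X3_def vector3_eq_axis_sum)

lemma du_translation_II:
  assumes "(f has_real_derivative p) (at u)"
  shows "du (translation_II f g) u v = vector [1, p, 0]"
  unfolding du_def translation_II_def
  by (rule vector_derivative_at, rule has_vector_derivative_vector3)
    (auto intro!: derivative_eq_intros assms)

lemma dv_translation_II:
  assumes "(g has_real_derivative q) (at v)"
  shows "dv (translation_II f g) u v = vector [0, q, 1]"
  unfolding dv_def translation_II_def
  by (rule vector_derivative_at, rule has_vector_derivative_vector3)
    (auto intro!: derivative_eq_intros assms)

lemma smooth_on_imp_DERIV:
  assumes "smooth_on S f" "x \<in> S"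
  shows "(f has_real_derivative deriv f x) (at x)"
    "(deriv f has_real_derivative deriv (deriv f) x) (at x)"
proof -
  have "(deriv ^^ 0) f field_differentiable (at x)" "(deriv ^^ 1) f field_differentiable (at x)"
    using assms unfolding smooth_on_def by blast+
  then show "(f has_real_derivative deriv f x) (at x)"
    "(deriv f has_real_derivative deriv (deriv f) x) (at x)"
    by (simp_all add: DERIV_deriv_iff_field_differentiable)
qed

lemma vector_derivative_cong_open:
  assumes "open S" "t \<in> S" "\<And>s. s \<in> S \<Longrightarrow> y s = z s"
    and "(z has_vector_derivative z') (at t)"
  shows "vector_derivative y (at t) = z'"
  using has_vector_derivative_transform_within_open[OF assms(4,1,2)] assms(3)
  by (auto intro!: vector_derivative_at)

text \<open>The vector \<open>-F E\<^sub>1 + E E\<^sub>2\<close> is the component of \<open>E E\<^sub>2\<close> orthogonal to \<open>E\<^sub>1\<close>; its square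
  \<open>E (E G - F\<^sup>2)\<close> has the sign of the Gram determinant \<open>E G - F\<^sup>2 = q\<^sup>2 - 1 - p\<^sup>2\<close>.\<close>

lemma spacelike_translation_II_imp_slopes:
  assumes "spacelike (translation_II f g) U V" "u \<in> U" "v \<in> V"
    and f: "(f has_real_derivative p) (at u)" and g: "(g has_real_derivative q) (at v)"
  shows "q\<^sup>2 > 1 + p\<^sup>2"
proof -
  let ?F = "translation_II f g"
  define \<alpha> \<beta> where "\<alpha> = - (p * q)" and "\<beta> = 1 + p\<^sup>2"
  have "1 + p\<^sup>2 > 0" by (simp add: add_pos_nonneg)
  then have "(\<alpha>, \<beta>) \<noteq> (0, 0)" by (simp add: \<beta>_def)
  then have "minkowski (\<alpha> *\<^sub>R du ?F u v + \<beta> *\<^sub>R dv ?F u v)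
               (\<alpha> *\<^sub>R du ?F u v + \<beta> *\<^sub>R dv ?F u v) > 0"
    using assms(1-3) unfolding spacelike_def by blast
  then have "\<alpha> * \<alpha> + (\<alpha> * p + \<beta> * q) * (\<alpha> * p + \<beta> * q) - \<beta> * \<beta> > 0"
    by (simp add: du_translation_II[OF f] dv_translation_II[OF g] minkowski_def)
  also have "\<alpha> * \<alpha> + (\<alpha> * p + \<beta> * q) * (\<alpha> * p + \<beta> * q) - \<beta> * \<beta> = (1 + p\<^sup>2) * (q\<^sup>2 - (1 + p\<^sup>2))"
    by (simp add: \<alpha>_def \<beta>_def power2_eq_square algebra_simps)
  finally show ?thesis
    using \<open>1 + p\<^sup>2 > 0\<close> by (simp add: zero_less_mult_iff)
qed

text \<open>The second fundamental form of the connection differs from the Levi-Civita one by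
  \<open>- g(E\<^sub>i, E\<^sub>j) g(X\<^sub>3, N)\<close>, the other correction term being tangential.  For the normal
  \<open>N = n\<^sub>2 (-p, 1, q)\<close> one has \<open>g(X\<^sub>3, N) = - n\<^sub>2 q\<close>, so the trace adds \<open>2 q (E G - F\<^sup>2)\<close> to the usual
  expression \<open>G p' + E q'\<close>, all up to the nonzero factor \<open>n\<^sub>2\<close>.\<close>

lemma minimal_translation_II_imp_ode:
  assumes "open U" "open V" "smooth_on U f" "smooth_on V g"
    and "unit_timelike_normal (translation_II f g) N U V"
    and "minimal (translation_II f g) N U V"
    and u: "u \<in> U" and v: "v \<in> V"
  shows "((deriv g v)\<^sup>2 - 1) * deriv (deriv f) u + (1 + (deriv f u)\<^sup>2) * deriv (deriv g) v
           + 2 * deriv g v * ((deriv g v)\<^sup>2 - 1 - (deriv f u)\<^sup>2) = 0"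
proof -
  let ?F = "translation_II f g"
  define p p' q q' where "p = deriv f u" and "p' = deriv (deriv f) u"
    and "q = deriv g v" and "q' = deriv (deriv g) v"
  note f = smooth_on_imp_DERIV[OF assms(3)] and g = smooth_on_imp_DERIV[OF assms(4)]
  have du: "du ?F s t = vector [1, deriv f s, 0]" if "s \<in> U" for s t
    using du_translation_II[OF f(1)[OF that]] .
  have dv: "dv ?F s t = vector [0, deriv g t, 1]" if "t \<in> V" for s t
    using dv_translation_II[OF g(1)[OF that]] .
  have duu: "du (du ?F) u v = vector [0, p', 0]"
    unfolding du_def[of "du ?F"] p'_def
    by (rule vector_derivative_cong_open[OF \<open>open U\<close> u du])
      (auto intro!: has_vector_derivative_vector3 derivative_eq_intros f u)
  have duv: "du (dv ?F) u v = 0"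
    unfolding du_def[of "dv ?F"] dv[OF v]
    by simp
  have dvu: "dv (du ?F) u v = 0"
    unfolding dv_def[of "du ?F"] du[OF u]
    by simp
  have dvv: "dv (dv ?F) u v = vector [0, q', 0]"
    unfolding dv_def[of "dv ?F"] q'_def
    by (rule vector_derivative_cong_open[OF \<open>open V\<close> v dv])
      (auto intro!: has_vector_derivative_vector3 derivative_eq_intros g v)
  define n1 n2 n3 where "n1 = N u v $ 1" and "n2 = N u v $ 2" and "n3 = N u v $ 3"
  note comps = minkowski_def n1_def[symmetric] n2_def[symmetric] n3_def[symmetric]
    p_def[symmetric] q_def[symmetric]
  have "minkowski (N u v) (du ?F u v) = 0" "minkowski (N u v) (dv ?F u v) = 0"
    and unit: "minkowski (N u v) (N u v) = -1"
    using assms(5) u v unfolding unit_timelike_normal_def by blast+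
  then have n1: "n1 = - p * n2" and n3: "n3 = q * n2"
    unfolding du[OF u] dv[OF v] by (simp_all add: comps algebra_simps)
  have "n2 \<noteq> 0"
    using unit n1 n3 by (auto simp: comps)
  have "coeff_G ?F u v * minkowski (nabla_along du ?F (du ?F) u v) (N u v)
      - coeff_F ?F u v * minkowski (nabla_along du ?F (dv ?F) u v) (N u v)
      - coeff_F ?F u v * minkowski (nabla_along dv ?F (du ?F) u v) (N u v)
      + coeff_E ?F u v * minkowski (nabla_along dv ?F (dv ?F) u v) (N u v) = 0"
    using assms(6) u v unfolding minimal_def by blast
  then have "n2 * ((q\<^sup>2 - 1) * p' + (1 + p\<^sup>2) * q' + 2 * q * (q\<^sup>2 - 1 - p\<^sup>2)) = 0"
    unfolding coeff_E_def coeff_F_def coeff_G_def nabla_along_def duu duv dvu dvv du[OF u] dv[OF v]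
      X3_eq_vector
    by (simp add: comps n1 n3 algebra_simps power2_eq_square)
  then show ?thesis
    using \<open>n2 \<noteq> 0\<close> by (simp add: p_def p'_def q_def q'_def)
qed

section \<open>One of the two slopes is constant\<close>

lemma constant_if_poly_roots:
  fixes h :: "real \<Rightarrow> real" and r :: "real poly"
  assumes "connected S" "continuous_on S h" "r \<noteq> 0" "\<And>x. x \<in> S \<Longrightarrow> poly r (h x) = 0"
  shows "h constant_on S"
proof -
  have "finite (h ` S)"
    by (rule finite_subset[OF _ poly_roots_finite[OF \<open>r \<noteq> 0\<close>]]) (use assms(4) in auto)
  then show ?thesis
    using continuous_finite_range_constant[OF assms(1,2)] by blast
qed

text \<open>The separated equation gives algebraic conditions, \<open>p\<^sup>2 = k\<close> on \<open>I\<close> or a monic cubic equation for \<open>q\<close>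
  on \<open>J\<close>; continuity and connectedness then select a single root.\<close>

lemma slope_constant_dichotomy:
  fixes p p' q q' :: "real \<Rightarrow> real"
  assumes "connected I" "connected J" "continuous_on I p" "continuous_on J q"
    and gt: "\<And>u v. u \<in> I \<Longrightarrow> v \<in> J \<Longrightarrow> (q v)\<^sup>2 > 1 + (p u)\<^sup>2"
    and ode: "\<And>u v. u \<in> I \<Longrightarrow> v \<in> J \<Longrightarrow>
      ((q v)\<^sup>2 - 1) * p' u + (1 + (p u)\<^sup>2) * q' v + 2 * q v * ((q v)\<^sup>2 - 1 - (p u)\<^sup>2) = 0"
  shows "p constant_on I \<or> q constant_on J"
proof (cases "\<exists>u1\<in>I. \<exists>u2\<in>I. (p u1)\<^sup>2 \<noteq> (p u2)\<^sup>2")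
  case True
  then obtain u1 u2 where u: "u1 \<in> I" "u2 \<in> I" and ne: "(p u1)\<^sup>2 \<noteq> (p u2)\<^sup>2" by blast
  \<comment> \<open>Eliminating \<open>q'\<close> between the equations at \<open>u\<^sub>1\<close> and \<open>u\<^sub>2\<close> gives \<open>q\<^sup>3 / (q\<^sup>2 - 1) = K\<close>.\<close>
  define K where "K = (p' u2 * (1 + (p u1)\<^sup>2) - p' u1 * (1 + (p u2)\<^sup>2)) / (2 * ((p u2)\<^sup>2 - (p u1)\<^sup>2))"
  define r where "r = [:K, 0, -K, 1:]"
  have "r \<noteq> 0" by (simp add: r_def)
  have "poly r (q v) = 0" if v: "v \<in> J" for v
  proof -
    define P1 P2 Q where "P1 = 1 + (p u1)\<^sup>2" and "P2 = 1 + (p u2)\<^sup>2" and "Q = (q v)\<^sup>2 - 1"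
    have K: "K * (2 * (P2 - P1)) = p' u2 * P1 - p' u1 * P2" and "P2 - P1 \<noteq> 0"
      using ne by (simp_all add: K_def P1_def P2_def)
    have Q: "Q > 0"
      using gt[OF u(1) v] by (simp add: Q_def) (smt (verit) zero_le_power2)
    have 1: "Q * p' u1 + P1 * q' v + 2 * q v * (Q - P1 + 1) = 0"
      and 2: "Q * p' u2 + P2 * q' v + 2 * q v * (Q - P2 + 1) = 0"
      using ode[OF u(1) v] ode[OF u(2) v] by (simp_all add: P1_def P2_def Q_def algebra_simps)
    have "Q * (p' u2 * P1 - p' u1 * P2) = 2 * q v * (Q + 1) * (P2 - P1)"
      using 1 2 by algebra
    then have "(2 * (P2 - P1)) * (q v * (Q + 1) - K * Q) = 0"
      using K by algebra
    then have "q v * (Q + 1) - K * Q = 0"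
      using \<open>P2 - P1 \<noteq> 0\<close> by simp
    then show ?thesis
      by (simp add: r_def Q_def algebra_simps power2_eq_square)
  qed
  then show ?thesis
    using constant_if_poly_roots[OF assms(2,4) \<open>r \<noteq> 0\<close>] by blast
next
  case False
  then obtain k where k: "\<And>u. u \<in> I \<Longrightarrow> (p u)\<^sup>2 = k" by metis
  have "[:-k, 0, 1:] \<noteq> (0 :: real poly)" by simp
  moreover have "poly [:-k, 0, 1:] (p u) = 0" if "u \<in> I" for u
    using k[OF that] by (simp add: power2_eq_square)
  ultimately show ?thesis
    using constant_if_poly_roots[OF assms(1,3)] by blast
qed

section \<open>The two ordinary differential equations\<close>

lemma DERIV_zero_constant_on:
  fixes h :: "real \<Rightarrow> real"
  assumes "open S" "connected S" "\<And>x. x \<in> S \<Longrightarrow> (h has_real_derivative 0) (at x)"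
  shows "h constant_on S"
proof -
  have "continuous_on S h"
    using assms(3) by (intro continuous_at_imp_continuous_on) (auto intro: DERIV_isCont)
  then show ?thesis
    using DERIV_zero_connected_constant[OF assms(2,1) finite.emptyI] assms(3)
    unfolding constant_on_def by blast
qed

lemma nonzero_constant_sign:
  fixes q :: "real \<Rightarrow> real"
  assumes "connected S" "continuous_on S q" "\<And>x. x \<in> S \<Longrightarrow> q x \<noteq> 0"
  obtains \<epsilon> where "\<epsilon> \<in> {1, -1}" "\<And>x. x \<in> S \<Longrightarrow> q x = \<epsilon> * \<bar>q x\<bar>"
proof -
  have "[:-1, 0, 1:] \<noteq> (0 :: real poly)" by simp
  moreover have "continuous_on S (\<lambda>x. sgn (q x))"
    using assms(2,3) by (intro continuous_on_sgn) auto
  moreover have "poly [:-1, 0, 1:] (sgn (q x)) = 0" if "x \<in> S" for x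
    using assms(3)[OF that] by (simp add: sgn_real_def)
  ultimately have "(\<lambda>x. sgn (q x)) constant_on S"
    by (intro constant_if_poly_roots[OF assms(1)])
  then obtain c where c: "\<And>x. x \<in> S \<Longrightarrow> sgn (q x) = c"
    unfolding constant_on_def by blast
  show ?thesis
  proof (cases "S = {}")
    case True
    then show ?thesis using that[of 1] by simp
  next
    case False
    then have "c \<in> {1, -1}"
      using c assms(3) by (force simp: sgn_real_def split: if_splits)
    then show ?thesis
      using that[of c] c by (metis sgn_mult_abs)
  qed
qed

text \<open>The function \<open>w = 1 / q\<^sup>2\<close> solves \<open>w' = 4 (1 / P - w)\<close>, so \<open>(w - 1 / P) e\<^bsup>4 v\<^esup>\<close> is constant.
  This constant is the number \<open>a\<close>, which would vanish only if \<open>q\<^sup>2 = P\<close>.\<close>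

lemma bernoulli_slope_solution:
  fixes q q' :: "real \<Rightarrow> real" and P :: real
  assumes "open J" "connected J" "J \<noteq> {}" "P > 0"
    and der: "\<And>v. v \<in> J \<Longrightarrow> (q has_real_derivative q' v) (at v)"
    and gt: "\<And>v. v \<in> J \<Longrightarrow> (q v)\<^sup>2 > P"
    and ode: "\<And>v. v \<in> J \<Longrightarrow> P * q' v + 2 * q v * ((q v)\<^sup>2 - P) = 0"
  obtains a \<epsilon> where "a \<noteq> 0" "\<epsilon> \<in> {1, -1}"
    "\<And>v. v \<in> J \<Longrightarrow> a * exp (- 4 * v) + 1 / P > 0"
    "\<And>v. v \<in> J \<Longrightarrow> q v = \<epsilon> / sqrt (a * exp (- 4 * v) + 1 / P)"
proof -
  have q0: "q v \<noteq> 0" if "v \<in> J" for v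
    using gt[OF that] \<open>P > 0\<close> by auto
  have "((\<lambda>v. (1 / (q v)\<^sup>2 - 1 / P) * exp (4 * v)) has_real_derivative 0) (at v)" if "v \<in> J" for v
  proof -
    have q': "q' v = - 2 * q v * ((q v)\<^sup>2 - P) / P"
      using ode[OF that] \<open>P > 0\<close> by (simp add: field_simps)
    have w: "((\<lambda>v. 1 / (q v)\<^sup>2) has_real_derivative 4 * (1 / P - 1 / (q v)\<^sup>2)) (at v)"
      using q0[OF that] \<open>P > 0\<close>
      by (auto intro!: derivative_eq_intros der[OF that] simp: q' field_simps power2_eq_square)
    have e: "((\<lambda>v. exp (4 * v)) has_real_derivative 4 * exp (4 * v)) (at v)"
      by (auto intro!: derivative_eq_intros)
    show ?thesis
      by (rule DERIV_cong[OF DERIV_mult[OF DERIV_diff[OF w DERIV_const] e]])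
        (simp add: algebra_simps)
  qed
  then have "(\<lambda>v. (1 / (q v)\<^sup>2 - 1 / P) * exp (4 * v)) constant_on J"
    by (rule DERIV_zero_constant_on[OF assms(1,2)])
  then obtain a where a: "\<And>v. v \<in> J \<Longrightarrow> (1 / (q v)\<^sup>2 - 1 / P) * exp (4 * v) = a"
    unfolding constant_on_def by blast
  have w: "a * exp (- 4 * v) + 1 / P = 1 / (q v)\<^sup>2" if "v \<in> J" for v
  proof -
    have "a * exp (- 4 * v) = (1 / (q v)\<^sup>2 - 1 / P) * (exp (4 * v) * exp (- 4 * v))"
      by (simp only: a[OF that, symmetric] mult.assoc)
    also have "exp (4 * v) * exp (- 4 * v) = 1"
      by (simp add: exp_minus)
    finally show ?thesis by simp
  qed
  have "continuous_on J q"
    by (intro continuous_at_imp_continuous_on) (auto intro: DERIV_isCont der)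
  then obtain \<epsilon> where \<epsilon>: "\<epsilon> \<in> {1, -1}" "\<And>v. v \<in> J \<Longrightarrow> q v = \<epsilon> * \<bar>q v\<bar>"
    using nonzero_constant_sign[OF assms(2)] q0 by metis
  show ?thesis
  proof (rule that)
    obtain v where "v \<in> J" using \<open>J \<noteq> {}\<close> by blast
    then show "a \<noteq> 0" using w[of v] gt[of v] \<open>P > 0\<close> by auto
    show "a * exp (- 4 * v) + 1 / P > 0" if "v \<in> J" for v
      using w[OF that] q0[OF that] by simp
    show "q v = \<epsilon> / sqrt (a * exp (- 4 * v) + 1 / P)" if "v \<in> J" for v
      unfolding w[OF that] using \<epsilon>(2)[OF that] by (simp add: real_sqrt_divide)
  qed (rule \<epsilon>)
qed

text \<open>The Moebius substitution \<open>R = (s + p) / (s - p)\<close> sends the constant solutions \<open>-s\<close> and \<open>s\<close> of the Riccati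
  equation to \<open>0\<close> and \<open>\<infinity>\<close>, and so turns it into \<open>R' = - (4 c / s) R\<close>.  The region between the
  constant solutions is the half line \<open>R > 0\<close>, so \<open>R = C e\<^bsup>- 4 c u / s\<^esup>\<close> with \<open>C > 0\<close>, and \<open>d\<close> is \<open>- 1 / C\<close>.\<close>

lemma riccati_slope_solution:
  fixes p p' :: "real \<Rightarrow> real" and c s :: real
  assumes "open I" "connected I" "I \<noteq> {}" "s > 0"
    and der: "\<And>u. u \<in> I \<Longrightarrow> (p has_real_derivative p' u) (at u)"
    and lt: "\<And>u. u \<in> I \<Longrightarrow> (p u)\<^sup>2 < s\<^sup>2"
    and ode: "\<And>u. u \<in> I \<Longrightarrow> s\<^sup>2 * p' u + 2 * c * (s\<^sup>2 - (p u)\<^sup>2) = 0"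
  obtains d where "d < 0"
    "\<And>u. u \<in> I \<Longrightarrow> p u = s * (1 + d * exp (4 * c / s * u)) / (1 - d * exp (4 * c / s * u))"
proof -
  have bounds: "s - p u > 0" "s + p u > 0" if "u \<in> I" for u
    using power_less_imp_less_base[of "\<bar>p u\<bar>" 2 s] lt[OF that] \<open>s > 0\<close> by auto
  have "((\<lambda>u. (s + p u) / (s - p u) * exp (4 * c / s * u)) has_real_derivative 0) (at u)"
    if "u \<in> I" for u
  proof -
    have p': "p' u = - 2 * c * (s\<^sup>2 - (p u)\<^sup>2) / s\<^sup>2"
      using ode[OF that] \<open>s > 0\<close> by (simp add: field_simps)
    have R: "((\<lambda>u. (s + p u) / (s - p u)) has_real_derivative
        - (4 * c / s) * ((s + p u) / (s - p u))) (at u)"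
      using bounds[OF that] \<open>s > 0\<close>
      by (auto intro!: derivative_eq_intros der[OF that] simp: p' divide_simps)
        (simp add: algebra_simps power2_eq_square)
    have e: "((\<lambda>u. exp (4 * c / s * u)) has_real_derivative 4 * c / s * exp (4 * c / s * u)) (at u)"
      using \<open>s > 0\<close> by (auto intro!: derivative_eq_intros)
    show ?thesis
      by (rule DERIV_cong[OF DERIV_mult[OF R e]]) simp
  qed
  then have "(\<lambda>u. (s + p u) / (s - p u) * exp (4 * c / s * u)) constant_on I"
    by (rule DERIV_zero_constant_on[OF assms(1,2)])
  then obtain C where C: "\<And>u. u \<in> I \<Longrightarrow> (s + p u) / (s - p u) * exp (4 * c / s * u) = C"
    unfolding constant_on_def by blast
  obtain u0 where "u0 \<in> I" using \<open>I \<noteq> {}\<close> by blast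
  then have "C > 0" using C[of u0] bounds[of u0] by (metis divide_pos_pos exp_gt_zero mult_pos_pos)
  show ?thesis
  proof (rule that[of "- 1 / C"])
    show "- 1 / C < 0" using \<open>C > 0\<close> by simp
    fix u assume u: "u \<in> I"
    define e where "e = exp (4 * c / s * u)"
    have "e > 0" by (simp add: e_def)
    have "(s + p u) / (s - p u) * e = C"
      using C[OF u] by (simp only: e_def)
    then have "(s + p u) * e = C * (s - p u)"
      using bounds[OF u] by (simp add: field_simps)
    then have "p u * (C + e) = s * (C - e)" by (simp add: algebra_simps)
    moreover have "C + e > 0" using \<open>C > 0\<close> \<open>e > 0\<close> by simp
    ultimately have "p u = s * (C - e) / (C + e)" by (simp add: field_simps)
    also have "\<dots> = s * (1 + (- 1 / C) * e) / (1 - (- 1 / C) * e)"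
      using \<open>C > 0\<close> \<open>C + e > 0\<close> by (simp add: divide_simps)
    finally show "p u = s * (1 + (- 1 / C) * exp (4 * c / s * u)) / (1 - (- 1 / C) * exp (4 * c / s * u))"
      by (simp add: e_def)
  qed
qed

section \<open>Recovering a function from its slope\<close>

text \<open>The base point \<open>x0\<close> may lie outside \<open>S\<close>, where \<open>F\<close> is unknown: only the integrand has to be
  continuous on an interval \<open>T\<close> containing both.\<close>

lemma antiderivative_eq_integral:
  fixes F h :: "real \<Rightarrow> real"
  assumes "open S" "connected S" "S \<subseteq> T" "open T" "connected T" "x0 \<in> T"
    and cont: "continuous_on T h"
    and der: "\<And>x. x \<in> S \<Longrightarrow> (F has_real_derivative h x) (at x)"
  obtains k where "\<And>x. x \<in> S \<Longrightarrow> F x = (LBINT t=x0..x. h t) + k"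
proof -
  have "((\<lambda>x. F x - (LBINT t=x0..x. h t)) has_real_derivative 0) (at x)" if x: "x \<in> S" for x
  proof -
    have "x \<in> T" using x assms(3) by blast
    then obtain e where e: "e > 0" "cball x e \<subseteq> T" using \<open>open T\<close> open_contains_cball by blast
    define a b where "a = min x0 (x - e)" and "b = max x0 (x + e)"
    have "x - e \<in> T" "x + e \<in> T"
      using e by (auto simp: cball_def dist_real_def subset_iff)
    then have "a \<in> T" "b \<in> T" using \<open>x0 \<in> T\<close> by (auto simp: a_def b_def min_def max_def)
    then have "{a..b} \<subseteq> T" using connected_contains_Icc[OF \<open>connected T\<close>] by blast
    then have "continuous_on {a..b} h" using cont continuous_on_subset by blast
    moreover have "a \<le> x0" "x0 \<le> b" "a < x" "x < b"
      using e(1) by (auto simp: a_def b_def)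
    ultimately have "((\<lambda>x. LBINT t=x0..x. h t) has_vector_derivative h x) (at x within {a..b})"
      by (intro interval_integral_FTC2) auto
    then have "((\<lambda>x. LBINT t=x0..x. h t) has_real_derivative h x) (at x)"
      using \<open>a < x\<close> \<open>x < b\<close>
      by (simp add: has_real_derivative_iff_has_vector_derivative at_within_Icc_at)
    then show ?thesis
      using der[OF x] by (auto intro!: derivative_eq_intros)
  qed
  then have "(\<lambda>x. F x - (LBINT t=x0..x. h t)) constant_on S"
    by (rule DERIV_zero_constant_on[OF assms(1,2)])
  then obtain k where "\<And>x. x \<in> S \<Longrightarrow> F x - (LBINT t=x0..x. h t) = k"
    unfolding constant_on_def by blast
  then show ?thesis using that[of k] by force
qed

lemma affine_if_slope_constant:
  fixes F :: "real \<Rightarrow> real"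
  assumes "open S" "connected S" "\<And>x. x \<in> S \<Longrightarrow> (F has_real_derivative c) (at x)"
  obtains k where "\<And>x. x \<in> S \<Longrightarrow> F x = c * x + k"
proof -
  have "((\<lambda>x. F x - c * x) has_real_derivative 0) (at x)" if "x \<in> S" for x
    using assms(3)[OF that] by (auto intro!: derivative_eq_intros)
  then have "(\<lambda>x. F x - c * x) constant_on S"
    by (rule DERIV_zero_constant_on[OF assms(1,2)])
  then obtain k where "\<And>x. x \<in> S \<Longrightarrow> F x - c * x = k"
    unfolding constant_on_def by blast
  then show ?thesis using that[of k] by force
qed

section \<open>The classification\<close>

theorem theorem3p2:
  fixes f g :: "real \<Rightarrow> real" and U V I J :: "real set" and N :: "real \<Rightarrow> real \<Rightarrow> real^3"
  assumes "open U" and "open V"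
    and "smooth_on U f" and "smooth_on V g"
    and "spacelike (translation_II f g) U V"
    and "unit_timelike_normal (translation_II f g) N U V"
    and "minimal (translation_II f g) N U V"
    and "I \<in> components U" and "J \<in> components V"
  shows
    "(\<exists>a b c. c \<noteq> 0 \<and> c\<^sup>2 < 1 \<and>
        (\<forall>u\<in>I. cos (2 * c / sqrt (1 - c\<^sup>2) * u - a) \<noteq> 0) \<and>
        (\<forall>u\<in>I. \<forall>v\<in>J. translation_II f g u v =
           vector [u, (1 - c\<^sup>2) / (2 * c) * ln \<bar>cos (2 * c / sqrt (1 - c\<^sup>2) * u - a)\<bar> + c * v + b, v]))
   \<or> (\<exists>b c d. c\<^sup>2 > 1 \<and> d \<noteq> 0 \<and>
        (\<forall>u\<in>I. \<forall>x\<in>closed_segment 0 u. 1 - d * exp (4 * c / sqrt (c\<^sup>2 - 1) * x) \<noteq> 0) \<and>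
        (\<forall>u\<in>I. \<forall>v\<in>J. translation_II f g u v =
           vector [u, (LBINT x=0..u. sqrt (c\<^sup>2 - 1) * (1 + d * exp (4 * c / sqrt (c\<^sup>2 - 1) * x))
                                       / (1 - d * exp (4 * c / sqrt (c\<^sup>2 - 1) * x))) + c * v + b, v]))
   \<or> (\<exists>a b c. \<exists>\<epsilon>\<in>{1, -1}. \<exists>v0\<in>J. a \<noteq> 0 \<and> (0 \<in> J \<longrightarrow> v0 = (0::real)) \<and>
        (\<forall>x\<in>J. a * exp (- 4 * x) + 1 / (c\<^sup>2 + 1) > 0) \<and>
        (\<forall>u\<in>I. \<forall>v\<in>J. translation_II f g u v =
           vector [u, (LBINT x=v0..v. \<epsilon> / sqrt (a * exp (- 4 * x) + 1 / (c\<^sup>2 + 1))) + c * u + b, v]))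
   \<or> (\<exists>b c0 c1. (c1 = 0 \<or> c1\<^sup>2 - c0\<^sup>2 - 2 = 0) \<and>
        (\<forall>u\<in>I. \<forall>v\<in>J. translation_II f g u v = vector [u, c0 * u + c1 * v + b, v]))"
  (is "?i \<or> ?ii \<or> ?iii \<or> ?iv")
proof -
  have I: "open I" "connected I" "I \<noteq> {}" "I \<subseteq> U"
    using open_components[OF assms(1,8)] in_components_connected[OF assms(8)]
      in_components_nonempty[OF assms(8)] in_components_subset[OF assms(8)] by auto
  have J: "open J" "connected J" "J \<noteq> {}" "J \<subseteq> V"
    using open_components[OF assms(2,9)] in_components_connected[OF assms(9)]
      in_components_nonempty[OF assms(9)] in_components_subset[OF assms(9)] by auto
  define p p' q q' where "p = deriv f" and "p' = deriv (deriv f)"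
    and "q = deriv g" and "q' = deriv (deriv g)"
  have f: "(f has_real_derivative p u) (at u)" and p: "(p has_real_derivative p' u) (at u)"
    if "u \<in> I" for u
    using smooth_on_imp_DERIV[OF assms(3)] that I(4) by (auto simp: p_def p'_def)
  have g: "(g has_real_derivative q v) (at v)" and q: "(q has_real_derivative q' v) (at v)"
    if "v \<in> J" for v
    using smooth_on_imp_DERIV[OF assms(4)] that J(4) by (auto simp: q_def q'_def)
  have gt: "(q v)\<^sup>2 > 1 + (p u)\<^sup>2" if "u \<in> I" "v \<in> J" for u v
    using spacelike_translation_II_imp_slopes[OF assms(5) _ _ f g] that I(4) J(4) by blast
  have ode: "((q v)\<^sup>2 - 1) * p' u + (1 + (p u)\<^sup>2) * q' v + 2 * q v * ((q v)\<^sup>2 - 1 - (p u)\<^sup>2) = 0"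
    if "u \<in> I" "v \<in> J" for u v
    using minimal_translation_II_imp_ode[OF assms(1-4,6,7)] that I(4) J(4)
    unfolding p_def p'_def q_def q'_def by blast
  obtain u0 v0 where u0: "u0 \<in> I" and "v0 \<in> J" using I(3) J(3) by blast
  have cont: "continuous_on I p" "continuous_on J q"
    by (auto intro!: continuous_at_imp_continuous_on DERIV_isCont p q)
  have "p constant_on I \<or> q constant_on J"
    by (rule slope_constant_dichotomy[OF I(2) J(2) cont gt ode])
  then show ?thesis
  proof
    assume "p constant_on I"
    then obtain c where p_const: "\<And>u. u \<in> I \<Longrightarrow> p u = c"
      unfolding constant_on_def by blast
    have "p' u0 = 0"
    proof -
      have "((\<lambda>_. c) has_real_derivative p' u0) (at u0)"
        by (rule has_field_derivative_transform_within_open[OF p[OF u0] I(1) u0 p_const])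
      then show ?thesis using DERIV_unique DERIV_const by blast
    qed
    have P: "c\<^sup>2 + 1 > 0" by (simp add: add_nonneg_pos)
    have q_gt: "(q v)\<^sup>2 > c\<^sup>2 + 1" if "v \<in> J" for v
      using gt[OF u0 that] p_const[OF u0] by simp
    have q_ode: "(c\<^sup>2 + 1) * q' v + 2 * q v * ((q v)\<^sup>2 - (c\<^sup>2 + 1)) = 0" if "v \<in> J" for v
      using ode[OF u0 that] p_const[OF u0] \<open>p' u0 = 0\<close> by (simp add: algebra_simps)
    obtain a \<epsilon> where a: "a \<noteq> 0" "\<epsilon> \<in> {1, -1}"
        "\<And>v. v \<in> J \<Longrightarrow> a * exp (- 4 * v) + 1 / (c\<^sup>2 + 1) > 0"
      and q_eq: "\<And>v. v \<in> J \<Longrightarrow> q v = \<epsilon> / sqrt (a * exp (- 4 * v) + 1 / (c\<^sup>2 + 1))"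
      by (rule bernoulli_slope_solution[OF J(1-3) P q q_gt q_ode]; blast)
    let ?h = "\<lambda>x. \<epsilon> / sqrt (a * exp (- 4 * x) + 1 / (c\<^sup>2 + 1))"
    define w where "w = (if 0 \<in> J then 0 else v0)"
    have w: "w \<in> J" "0 \<in> J \<longrightarrow> w = 0" using \<open>v0 \<in> J\<close> by (auto simp: w_def)
    have h: "continuous_on J ?h"
      using cont(2) q_eq by (simp cong: continuous_on_cong)
    have "(g has_real_derivative ?h v) (at v)" if "v \<in> J" for v
      using g[OF that] q_eq[OF that] by simp
    then obtain k where k: "\<And>v. v \<in> J \<Longrightarrow> g v = (LBINT x=w..v. ?h x) + k"
      using antiderivative_eq_integral[OF J(1,2) subset_refl J(1,2) w(1) h] by blast
    have "(f has_real_derivative c) (at u)" if "u \<in> I" for u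
      using f[OF that] p_const[OF that] by simp
    then obtain l where l: "\<And>u. u \<in> I \<Longrightarrow> f u = c * u + l"
      using affine_if_slope_constant[OF I(1,2)] by blast
    have "translation_II f g u v = vector [u, (LBINT x=w..v. ?h x) + c * u + (k + l), v]"
      if "u \<in> I" "v \<in> J" for u v
      unfolding translation_II_def k[OF that(2)] l[OF that(1)] by (simp add: algebra_simps)
    then have ?iii using a w by blast
    then show ?thesis by blast
  next
    assume "q constant_on J"
    then obtain c where q_const: "\<And>v. v \<in> J \<Longrightarrow> q v = c"
      unfolding constant_on_def by blast
    have "q' v0 = 0"
    proof -
      have "((\<lambda>_. c) has_real_derivative q' v0) (at v0)"
        by (rule has_field_derivative_transform_within_open[OF q J(1) _ q_const]) (rule \<open>v0 \<in> J\<close>)+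
      then show ?thesis using DERIV_unique DERIV_const by blast
    qed
    have p_lt': "1 + (p u)\<^sup>2 < c\<^sup>2" if "u \<in> I" for u
      using gt[OF that \<open>v0 \<in> J\<close>] q_const[OF \<open>v0 \<in> J\<close>] by simp
    have c: "c\<^sup>2 > 1"
      using p_lt'[OF u0] by (smt (verit) zero_le_power2)
    define s where "s = sqrt (c\<^sup>2 - 1)"
    have s: "s > 0" "s\<^sup>2 = c\<^sup>2 - 1" using c by (simp_all add: s_def)
    have p_lt: "(p u)\<^sup>2 < s\<^sup>2" if "u \<in> I" for u
      using p_lt'[OF that] s(2) by simp
    have p_ode: "s\<^sup>2 * p' u + 2 * c * (s\<^sup>2 - (p u)\<^sup>2) = 0" if "u \<in> I" for u
      using ode[OF that \<open>v0 \<in> J\<close>] q_const[OF \<open>v0 \<in> J\<close>] \<open>q' v0 = 0\<close> s(2) by simp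
    obtain d where d: "d < 0" and p_eq:
        "\<And>u. u \<in> I \<Longrightarrow> p u = s * (1 + d * exp (4 * c / s * u)) / (1 - d * exp (4 * c / s * u))"
      by (rule riccati_slope_solution[OF I(1-3) s(1) p p_lt p_ode]; blast)
    let ?h = "\<lambda>x. s * (1 + d * exp (4 * c / s * x)) / (1 - d * exp (4 * c / s * x))"
    have den: "1 - d * exp (4 * c / s * x) \<noteq> 0" for x
      using mult_neg_pos[OF d exp_gt_zero[of "4 * c / s * x"]] by linarith
    have h: "continuous_on UNIV ?h"
      using den s(1) by (intro continuous_intros) auto
    have "(f has_real_derivative ?h u) (at u)" if "u \<in> I" for u
      using f[OF that] p_eq[OF that] by simp
    then obtain k where k: "\<And>u. u \<in> I \<Longrightarrow> f u = (LBINT x=(0::real)..u. ?h x) + k"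
      using antiderivative_eq_integral[OF I(1,2) subset_UNIV open_UNIV connected_UNIV UNIV_I h]
      by blast
    have "(g has_real_derivative c) (at v)" if "v \<in> J" for v
      using g[OF that] q_const[OF that] by simp
    then obtain l where l: "\<And>v. v \<in> J \<Longrightarrow> g v = c * v + l"
      using affine_if_slope_constant[OF J(1,2)] by blast
    have "translation_II f g u v = vector [u, (LBINT x=0..u. ?h x) + c * v + (k + l), v]"
      if "u \<in> I" "v \<in> J" for u v
      unfolding translation_II_def k[OF that(1)] l[OF that(2)]
      by (simp add: algebra_simps zero_ereal_def)
    moreover have "d \<noteq> 0" using d by simp
    ultimately have ?ii using c den unfolding s_def by blast
    then show ?thesis by blast
  qed
qed

end
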